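(* Let $\sigma$ be an operator mean with representing function $f$, and let $g$ be a real-valued function on $(0,\infty)$. (a) Suppose that for every operator mean $\tau$, $$(A\tau B)\,\sigma\,(A\tau^{\perp}B)\le A\sigma B\quad\text{for all positive definite }A,B,$$ and that $f(x)>\sqrt x$ for some $x\in(1,\infty)$. If $g(A\#B)\le g(A\sigma B)$ for all positive definite $A,B$, then $g$ is operator monotone on $(0,\infty)$. (b) Suppose that for every operator mean $\tau$, $$(A\tau B)\,\sigma\,(A\tau^{\perp}B)\ge A\sigma B\quad\text{for all positive definite }A,B,$$ and that $f(x)<\sqrt x$ for some $x\in(0,1)$. If $g(A\#B)\ge g(A\sigma B)$ for all positive definite $A,B$, then $g$ is operator monotone on $(0,\infty)$.
   Context: Positive operators are taken to be positive definite complex $n\times n$ matrices, $n$ arbitrary; $\le$ is the Loewner order and functions of Hermitian matrices are defined by functional calculus. A real function $g$ on $(0,\infty)$ is operator monotone if for every $n$ and all positive definite $n\times n$ matrices $X\le Y$ one has $g(X)\le g(Y)$. An operator mean $\sigma$ (Kubo-Ando mean) is given by its representing function $f:(0,\infty)\to(0,\infty)$, operator monotone with $f(1)=1$, via $A\sigma B=A^{1/2}f(A^{-1/2}BA^{-1/2})A^{1/2}$. The geometric mean $\#$ has representing function $\sqrt t$. If $\tau$ is the operator mean with representing function $k$, then $\tau^{\perp}$ denotes the operator mean with representing function $k^\dagger(t)=t/k(t)$. *)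

theory Defs
  imports "Jordan_Normal_Form.Schur_Decomposition"
begin

definition hermitian_mat :: "complex mat \<Rightarrow> bool" where
  "hermitian_mat A \<longleftrightarrow> square_mat A \<and> mat_adjoint A = A"

definition unitary_mat :: "complex mat \<Rightarrow> bool" where
  "unitary_mat U \<longleftrightarrow> square_mat U \<and>
     mat_adjoint U * U = 1\<^sub>m (dim_row U) \<and> U * mat_adjoint U = 1\<^sub>m (dim_row U)"

text \<open>
  The order on \<open>complex\<close> is the one of \<open>HOL-Library.Complex_Order\<close>: \<open>0 \<le> z\<close> and \<open>0 < z\<close> mean
  that \<open>z\<close> is real and nonnegative, respectively positive.
\<close>

definition positive_semidefinite :: "complex mat \<Rightarrow> bool" where
  "positive_semidefinite A \<longleftrightarrow> hermitian_mat A \<and>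
     (\<forall>v\<in>carrier_vec (dim_row A). 0 \<le> (A *\<^sub>v v) \<bullet>c v)"

definition positive_definite :: "nat \<Rightarrow> complex mat \<Rightarrow> bool" where
  "positive_definite n A \<longleftrightarrow> A \<in> carrier_mat n n \<and> hermitian_mat A \<and>
     (\<forall>v\<in>carrier_vec n. v \<noteq> 0\<^sub>v n \<longrightarrow> 0 < (A *\<^sub>v v) \<bullet>c v)"

definition loewner_le :: "complex mat \<Rightarrow> complex mat \<Rightarrow> bool" where
  "loewner_le A B \<longleftrightarrow> hermitian_mat A \<and> hermitian_mat B \<and> dim_row A = dim_row B \<and>
     positive_semidefinite (B - A)"

definition diagonalization :: "complex mat \<Rightarrow> complex mat \<Rightarrow> (nat \<Rightarrow> real) \<Rightarrow> bool" where
  "diagonalization A U d \<longleftrightarrow> unitary_mat U \<and>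
     A = U * mat_diag (dim_row U) (\<lambda>i. complex_of_real (d i)) * mat_adjoint U"

text \<open>
  Functional calculus for Hermitian matrices. The result does not depend on the chosen
  diagonalization, see \<open>fun_mat_eq\<close> below. Only the values of \<open>f\<close> on the spectrum of \<open>A\<close> matter, so
  functions on the open positive half-line are modelled as total functions on \<open>real\<close> whose other
  values are irrelevant when \<open>A\<close> is positive definite.
\<close>

definition fun_mat :: "(real \<Rightarrow> real) \<Rightarrow> complex mat \<Rightarrow> complex mat" where
  "fun_mat f A = (THE B. \<exists>U d. diagonalization A U d \<and> diagonalization B U (\<lambda>i. f (d i)))"

lemma mat_adjoint_dim [simp]:
  "dim_row (mat_adjoint U) = dim_col U" "dim_col (mat_adjoint U) = dim_row U"
  by (auto simp: mat_adjoint_def)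

lemma diagonalization_unique:
  assumes "diagonalization A U d" "diagonalization A V e"
    and "diagonalization B U (\<lambda>i. f (d i))" "diagonalization C V (\<lambda>i. f (e i))"
  shows "B = C"
proof -
  define n where "n = dim_row A"
  let ?D = "\<lambda>d. mat_diag n (\<lambda>i. complex_of_real (d i))"
  let ?U' = "mat_adjoint U" and ?V' = "mat_adjoint V"
  have U_un: "unitary_mat U" and V_un: "unitary_mat V"
    using assms(1,2) by (simp_all add: diagonalization_def)
  have dims: "dim_row U = n" "dim_row V = n"
  proof -
    have "dim_row A = dim_row U"
      using arg_cong[OF conjunct2[OF assms(1)[unfolded diagonalization_def]], of dim_row]
      by (simp only: index_mult_mat)
    thus "dim_row U = n" by (simp only: n_def)
    have "dim_row A = dim_row V"
      using arg_cong[OF conjunct2[OF assms(2)[unfolded diagonalization_def]], of dim_row]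
      by (simp only: index_mult_mat)
    thus "dim_row V = n" by (simp only: n_def)
  qed
  have carr: "X \<in> carrier_mat n n" "mat_adjoint X \<in> carrier_mat n n"
    "mat_adjoint X * X = 1\<^sub>m n" "X * mat_adjoint X = 1\<^sub>m n"
    if "unitary_mat X" "dim_row X = n" for X
  proof -
    have "dim_col X = n" using that by (simp add: unitary_mat_def)
    with that(2) show "X \<in> carrier_mat n n" "mat_adjoint X \<in> carrier_mat n n"
      by (auto intro: carrier_matI)
    show "mat_adjoint X * X = 1\<^sub>m n" "X * mat_adjoint X = 1\<^sub>m n"
      using that(1) unfolding unitary_mat_def that(2) by blast+
  qed
  note U = carr[OF U_un dims(1)] and V = carr[OF V_un dims(2)]
  note diag = assms[unfolded diagonalization_def dims, THEN conjunct2]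
  have A: "A = U * ?D d * ?U'" "A = V * ?D e * ?V'"
    and B: "B = U * ?D (\<lambda>i. f (d i)) * ?U'" and C: "C = V * ?D (\<lambda>i. f (e i)) * ?V'"
    by (rule diag)+
  have D: "?D h \<in> carrier_mat n n" for h by simp
  have cancel_U: "U * X * ?U' * U = U * X" and cancel_V: "?V' * (V * (X * Y)) = X * Y"
    if X: "X \<in> carrier_mat n n" and Y: "Y \<in> carrier_mat n n" for X Y
  proof -
    have "U * X * ?U' * U = U * X * (?U' * U)"
      by (rule assoc_mult_mat[OF mult_carrier_mat[OF U(1) X] U(2) U(1)])
    thus "U * X * ?U' * U = U * X"
      using right_mult_one_mat[OF mult_carrier_mat[OF U(1) X]] U(3) by simp
    have "?V' * (V * (X * Y)) = ?V' * V * (X * Y)"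
      by (rule assoc_mult_mat[OF V(2) V(1) mult_carrier_mat[OF X Y], symmetric])
    thus "?V' * (V * (X * Y)) = X * Y"
      using left_mult_one_mat[OF mult_carrier_mat[OF X Y]] V(3) by simp
  qed
  define W where "W = ?V' * U"
  have W: "W \<in> carrier_mat n n" unfolding W_def by (rule mult_carrier_mat[OF V(2) U(1)])
  have VW: "V * W = U"
    unfolding W_def assoc_mult_mat[OF V(1) V(2) U(1), symmetric] V(4)
    by (rule left_mult_one_mat[OF U(1)])
  have WU: "W * ?U' = ?V'"
    unfolding W_def assoc_mult_mat[OF V(2) U(1) U(2)] U(4)
    by (rule right_mult_one_mat[OF V(2)])
  have left: "?V' * (U * ?D h * ?U' * U) = W * ?D h" for h
    unfolding cancel_U[OF D D] W_def by (rule assoc_mult_mat[OF V(2) U(1) D, symmetric])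
  have right: "?V' * (V * ?D h * ?V' * U) = ?D h * W" for h
  proof -
    have "V * ?D h * ?V' * U = V * ?D h * W"
      unfolding W_def by (rule assoc_mult_mat[OF mult_carrier_mat[OF V(1) D] V(2) U(1)])
    also have "\<dots> = V * (?D h * W)" by (rule assoc_mult_mat[OF V(1) D W])
    finally show ?thesis using cancel_V[OF D W] by simp
  qed
  have WD_eq: "W * ?D d = ?D e * W"
    unfolding left[of d, symmetric] right[of e, symmetric] A(1)[symmetric] A(2)[symmetric] ..
  have WD: "W $$ (i,j) * complex_of_real (d j) = complex_of_real (e i) * W $$ (i,j)"
    if ij: "i < n" "j < n" for i j
  proof -
    have "(W * ?D d) $$ (i,j) = W $$ (i,j) * complex_of_real (d j)"
      unfolding mat_diag_mult_right[OF W] using ij by simp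
    moreover have "(?D e * W) $$ (i,j) = complex_of_real (e i) * W $$ (i,j)"
      unfolding mat_diag_mult_left[OF W] using ij by simp
    ultimately show ?thesis using WD_eq by metis
  qed
  have "W $$ (i,j) * complex_of_real (f (d j)) = complex_of_real (f (e i)) * W $$ (i,j)"
    if "i < n" "j < n" for i j
    using WD[OF that] by (cases "W $$ (i,j) = 0") auto
  hence W_f: "W * ?D (\<lambda>i. f (d i)) = ?D (\<lambda>i. f (e i)) * W"
    unfolding mat_diag_mult_left[OF W] mat_diag_mult_right[OF W] by (intro eq_matI) auto
  have "B = V * W * ?D (\<lambda>i. f (d i)) * ?U'" unfolding B VW ..
  also have "V * W * ?D (\<lambda>i. f (d i)) = V * (W * ?D (\<lambda>i. f (d i)))"
    by (rule assoc_mult_mat[OF V(1) W D])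
  also have "\<dots> = V * ?D (\<lambda>i. f (e i)) * W"
    unfolding W_f by (rule assoc_mult_mat[OF V(1) D W, symmetric])
  also have "\<dots> * ?U' = V * ?D (\<lambda>i. f (e i)) * (W * ?U')"
    by (rule assoc_mult_mat[OF mult_carrier_mat[OF V(1) D] W U(2)])
  finally show ?thesis unfolding C WU .
qed

lemma fun_mat_eq:
  assumes "diagonalization A U d"
  shows "fun_mat f A = U * mat_diag (dim_row U) (\<lambda>i. complex_of_real (f (d i))) * mat_adjoint U"
    (is "_ = ?B")
proof -
  have B: "diagonalization ?B U (\<lambda>i. f (d i))"
    using assms by (auto simp: diagonalization_def)
  show ?thesis
    unfolding fun_mat_def
  proof (rule the_equality)
    show "\<exists>U d. diagonalization A U d \<and> diagonalization ?B U (\<lambda>i. f (d i))"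
      using assms B by blast
  next
    fix C
    assume "\<exists>V e. diagonalization A V e \<and> diagonalization C V (\<lambda>i. f (e i))"
    then obtain V e where "diagonalization A V e" "diagonalization C V (\<lambda>i. f (e i))" by blast
    from diagonalization_unique[OF this(1) assms this(2) B] show "C = ?B" .
  qed
qed

definition operator_monotone :: "(real \<Rightarrow> real) \<Rightarrow> bool" where
  "operator_monotone g \<longleftrightarrow>
     (\<forall>n X Y. positive_definite n X \<and> positive_definite n Y \<and> loewner_le X Y
        \<longrightarrow> loewner_le (fun_mat g X) (fun_mat g Y))"

definition representing_function :: "(real \<Rightarrow> real) \<Rightarrow> bool" where
  "representing_function f \<longleftrightarrow> (\<forall>t>0. 0 < f t) \<and> operator_monotone f \<and> f 1 = 1"

text \<open>
  An operator mean is represented by its representing function: \<open>op_mean f A B\<close> is \<open>A \<sigma> B\<close> for the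
  operator mean \<open>\<sigma>\<close> with representing function \<open>f\<close>.
\<close>

definition op_mean :: "(real \<Rightarrow> real) \<Rightarrow> complex mat \<Rightarrow> complex mat \<Rightarrow> complex mat" where
  "op_mean f A B =
     (let S = fun_mat (\<lambda>x. x powr (1/2)) A; R = fun_mat (\<lambda>x. x powr (-1/2)) A
      in S * fun_mat f (R * B * R) * S)"

definition geometric_mean :: "complex mat \<Rightarrow> complex mat \<Rightarrow> complex mat" where
  "geometric_mean = op_mean sqrt"

definition perp_fun :: "(real \<Rightarrow> real) \<Rightarrow> real \<Rightarrow> real" where
  "perp_fun k t = t / k t"

end

theory Submission
  imports Defs "Jordan_Normal_Form.Spectral_Radius"
begin

text \<open>
  Congruence invariance of operator means computes \<open>A \<sigma> B\<close> whenever \<open>A = T diag(a) T\<^sup>*\<close> and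
  \<open>B = T diag(b) T\<^sup>*\<close> with the same invertible \<open>T\<close>: the result is \<open>T diag(a f(b/a)) T\<^sup>*\<close>.
  Two positive definite matrices \<open>X \<le> Y\<close> can be written as \<open>X = T T\<^sup>*\<close> and \<open>Y = T diag(d) T\<^sup>*\<close>
  with \<open>d \<ge> 1\<close>. If \<open>d\<^sub>i = f(t\<^sub>i) / \<surd>t\<^sub>i\<close> for all \<open>i\<close>, then \<open>A = T diag(1/\<surd>t) T\<^sup>*\<close> and
  \<open>B = T diag(\<surd>t) T\<^sup>*\<close> satisfy \<open>A # B = X\<close> and \<open>A \<sigma> B = Y\<close>, and the hypothesis on \<open>g\<close> applies.
  By continuity the values of \<open>f(t) / \<surd>t\<close> fill an interval with endpoint \<open>f(1) = 1\<close>, so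
  \<open>g(X) \<le> g(Y)\<close> holds if \<open>d\<close> is close to \<open>1\<close>, and in general by joining \<open>X\<close> to \<open>Y\<close> by a chain of
  such steps. Continuity comes from the hypothesis on \<open>\<tau>\<close>: for \<open>A \<tau> B = B\<close> and scalars it gives
  \<open>f(t) = t f(1/t)\<close>, so that \<open>f(t)/t\<close> is nonincreasing while \<open>f\<close> is nondecreasing.
\<close>

subsection \<open>Congruences of real diagonal matrices\<close>

text \<open>Common normal form for all matrices below: with \<open>T\<close> unitary it is a
  spectral decomposition, with \<open>T\<close> merely invertible a congruence. Since
  \<open>T\<close> may be rectangular, \<open>n\<close> records the length of the diagonal.\<close>

definition cdiag :: "nat \<Rightarrow> complex mat \<Rightarrow> (nat \<Rightarrow> real) \<Rightarrow> complex mat" where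
  "cdiag n T d = T * mat_diag n (\<lambda>i. complex_of_real (d i)) * mat_adjoint T"

lemma index_mat_adjoint [simp]:
  "i < dim_col A \<Longrightarrow> j < dim_row A \<Longrightarrow> mat_adjoint A $$ (i, j) = conjugate (A $$ (j, i))"
  by (simp add: mat_adjoint_def mat_of_rows_def)

lemma mat_adjoint_carrier [simp]:
  "A \<in> carrier_mat n m \<Longrightarrow> mat_adjoint A \<in> carrier_mat m n"
  by (auto intro: carrier_matI)

lemma mat_adjoint_adjoint [simp]: "mat_adjoint (mat_adjoint A) = A"
  by (rule eq_matI) auto

lemma mat_adjoint_mult:
  fixes A B :: "complex mat"
  assumes "A \<in> carrier_mat n m" "B \<in> carrier_mat m k"
  shows "mat_adjoint (A * B) = mat_adjoint B * mat_adjoint A"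
  using assms by (intro eq_matI) (auto simp: scalar_prod_def mult.commute intro!: sum.cong)

lemma mat_adjoint_diag [simp]:
  "mat_adjoint (mat_diag n (\<lambda>i. complex_of_real (d i))) = mat_diag n (\<lambda>i. complex_of_real (d i))"
  by (rule eq_matI) (auto simp: mat_diag_def)

lemma mat_adjoint_one [simp]: "mat_adjoint (1\<^sub>m n :: complex mat) = 1\<^sub>m n"
  by (rule eq_matI) auto

lemma adjoint_sprod:
  fixes A :: "complex mat"
  assumes "A \<in> carrier_mat n m" "v \<in> carrier_vec m" "w \<in> carrier_vec n"
  shows "(A *\<^sub>v v) \<bullet>c w = v \<bullet>c (mat_adjoint A *\<^sub>v w)"
proof -
  have "(A *\<^sub>v v) \<bullet>c w = (\<Sum>i<n. \<Sum>j<m. A $$ (i,j) * v $ j * conjugate (w $ i))"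
    using assms by (auto simp: scalar_prod_def sum_distrib_right atLeast0LessThan intro!: sum.cong)
  also have "\<dots> = (\<Sum>j<m. \<Sum>i<n. A $$ (i,j) * v $ j * conjugate (w $ i))"
    by (rule sum.swap)
  also have "\<dots> = v \<bullet>c (mat_adjoint A *\<^sub>v w)"
    using assms by (auto simp: scalar_prod_def sum_distrib_left atLeast0LessThan algebra_simps intro!: sum.cong)
  finally show ?thesis .
qed

lemma cdiag_carrier [simp]: "T \<in> carrier_mat m n \<Longrightarrow> cdiag n T d \<in> carrier_mat m m"
  unfolding cdiag_def by (intro mult_carrier_mat) auto

lemma cdiag_adjoint:
  assumes "T \<in> carrier_mat m n"
  shows "mat_adjoint (cdiag n T d) = cdiag n T d"
proof -
  let ?D = "mat_diag n (\<lambda>i. complex_of_real (d i))"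
  have "mat_adjoint (T * ?D * mat_adjoint T) = mat_adjoint (mat_adjoint T) * mat_adjoint (T * ?D)"
    using assms by (intro mat_adjoint_mult[of _ m n]) auto
  also have "mat_adjoint (T * ?D) = ?D * mat_adjoint T"
    using assms by (subst mat_adjoint_mult[of _ m n _ n]) auto
  finally show ?thesis
    using assms by (simp add: cdiag_def assoc_mult_mat[of _ m n _ n _ m])
qed

lemma hermitian_cdiag:
  assumes "T \<in> carrier_mat m n"
  shows "hermitian_mat (cdiag n T d)"
  using cdiag_carrier[OF assms, of d] cdiag_adjoint[OF assms, of d] by (auto simp: hermitian_mat_def)

text \<open>Congruence by \<open>S\<close> leaves the diagonal untouched and only replaces the frame
  \<open>T\<close> by \<open>S * T\<close>; every computation with means reduces to this.\<close>

lemma cdiag_congruence: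
  assumes "S \<in> carrier_mat k m" "T \<in> carrier_mat m n"
  shows "S * cdiag n T d * mat_adjoint S = cdiag n (S * T) d"
proof -
  let ?D = "mat_diag n (\<lambda>i. complex_of_real (d i))"
  have "cdiag n (S * T) d = S * T * ?D * (mat_adjoint T * mat_adjoint S)"
    using assms by (simp add: cdiag_def mat_adjoint_mult[of S k m T n])
  also have "\<dots> = S * T * ?D * mat_adjoint T * mat_adjoint S"
    using assms
    by (intro assoc_mult_mat[symmetric, of _ k n _ m _ k] mult_carrier_mat[of _ k n] mult_carrier_mat[of _ k m]) auto
  also have "S * T * ?D * mat_adjoint T = S * (T * ?D * mat_adjoint T)"
  proof -
    have "S * T * ?D = S * (T * ?D)" using assms by (intro assoc_mult_mat[of _ k m _ n _ n]) auto
    moreover have "S * (T * ?D) * mat_adjoint T = S * (T * ?D * mat_adjoint T)"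
      using assms by (intro assoc_mult_mat[of _ k m _ n _ m] mult_carrier_mat[of _ m n]) auto
    ultimately show ?thesis by simp
  qed
  finally show ?thesis by (simp add: cdiag_def)
qed

text \<open>Scaling the columns of \<open>T\<close> by \<open>s\<close> moves the factor
  \<open>s i\<close> squared into the diagonal. Used to normalise the first argument of a mean to
  diagonal 1.\<close>

lemma cdiag_scale:
  assumes "T \<in> carrier_mat m n"
  shows "cdiag n (T * mat_diag n (\<lambda>i. complex_of_real (s i))) d = cdiag n T (\<lambda>i. d i * (s i)\<^sup>2)"
proof -
  let ?D = "\<lambda>d. mat_diag n (\<lambda>i. complex_of_real (d i))"
  have "cdiag n (T * ?D s) d = T * cdiag n (?D s) d * mat_adjoint T"
    using assms by (intro cdiag_congruence[symmetric]) auto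
  also have "cdiag n (?D s) d = ?D (\<lambda>i. d i * (s i)\<^sup>2)"
    by (simp add: cdiag_def power2_eq_square mult_ac)
  finally show ?thesis by (simp add: cdiag_def)
qed

lemma cdiag_index:
  assumes "T \<in> carrier_mat m n" "i < m" "j < m"
  shows "cdiag n T d $$ (i, j) = (\<Sum>k<n. T $$ (i, k) * complex_of_real (d k) * cnj (T $$ (j, k)))"
  using assms unfolding cdiag_def mat_diag_mult_right[OF assms(1)]
  by (auto simp: scalar_prod_def atLeast0LessThan intro!: sum.cong)

lemma cdiag_diff:
  assumes "T \<in> carrier_mat m n"
  shows "cdiag n T d - cdiag n T e = cdiag n T (\<lambda>i. d i - e i)"
proof (rule eq_matI)
  note dims = carrier_matD[OF cdiag_carrier[OF assms]]
  fix i j assume "i < dim_row (cdiag n T (\<lambda>i. d i - e i))" "j < dim_col (cdiag n T (\<lambda>i. d i - e i))"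
  then have ij: "i < m" "j < m" by (simp_all add: dims)
  then show "(cdiag n T d - cdiag n T e) $$ (i, j) = cdiag n T (\<lambda>i. d i - e i) $$ (i, j)"
    by (simp add: dims cdiag_index[OF assms] sum_subtractf[symmetric] algebra_simps)
qed (auto simp: carrier_matD[OF cdiag_carrier[OF assms]])

text \<open>Moving \<open>T\<close> to the other side of the inner product turns the quadratic form
  into a weighted sum of squares in the coordinates of \<open>mat_adjoint T *\<^sub>v v\<close>, so
  definiteness depends on the signs of \<open>d\<close>.\<close>

lemma cdiag_sprod:
  assumes T: "T \<in> carrier_mat m n" and v: "v \<in> carrier_vec m"
  shows "(cdiag n T d *\<^sub>v v) \<bullet>c v = complex_of_real (\<Sum>i<n. d i * (cmod ((mat_adjoint T *\<^sub>v v) $ i))\<^sup>2)"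
proof -
  let ?D = "mat_diag n (\<lambda>i. complex_of_real (d i))"
  define w where "w = mat_adjoint T *\<^sub>v v"
  have w: "w \<in> carrier_vec n"
    unfolding w_def using mat_adjoint_carrier[OF T] v by (rule mult_mat_vec_carrier)
  have D: "?D \<in> carrier_mat n n" by simp
  have Dw: "?D *\<^sub>v w \<in> carrier_vec n" using D by (rule mult_mat_vec_carrier[OF _ w])
  have "cdiag n T d *\<^sub>v v = (T * ?D) *\<^sub>v w"
    unfolding cdiag_def w_def using T v by (intro assoc_mult_mat_vec[of _ m n _ m] mult_carrier_mat[of _ m n]) auto
  also have "\<dots> = T *\<^sub>v (?D *\<^sub>v w)" by (rule assoc_mult_mat_vec[OF T D w])
  finally have "(cdiag n T d *\<^sub>v v) \<bullet>c v = (?D *\<^sub>v w) \<bullet>c w"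
    unfolding w_def using adjoint_sprod[OF T Dw v] by (simp add: w_def)
  also have "?D *\<^sub>v w = vec n (\<lambda>i. complex_of_real (d i) * w $ i)"
  proof (rule eq_vecI)
    fix i assume i: "i < dim_vec (vec n (\<lambda>i. complex_of_real (d i) * w $ i))"
    have "(?D *\<^sub>v w) $ i = (\<Sum>j<n. (if i = j then complex_of_real (d j) else 0) * w $ j)"
      using i w by (auto simp: mat_diag_def scalar_prod_def atLeast0LessThan intro!: sum.cong)
    also have "\<dots> = (\<Sum>j<n. (if i = j then complex_of_real (d j) * w $ j else 0))"
      by (rule sum.cong) auto
    finally show "(?D *\<^sub>v w) $ i = vec n (\<lambda>i. complex_of_real (d i) * w $ i) $ i"
      using i by (simp add: sum.delta)
  qed (simp add: mat_diag_def)
  also have "\<dots> \<bullet>c w = (\<Sum>i<n. complex_of_real (d i) * (w $ i * cnj (w $ i)))"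
    using w by (auto simp: scalar_prod_def atLeast0LessThan mult.assoc intro!: sum.cong)
  also have "\<dots> = complex_of_real (\<Sum>i<n. d i * (cmod (w $ i))\<^sup>2)"
    by (simp only: of_real_sum of_real_mult complex_norm_square)
  finally show ?thesis unfolding w_def .
qed

section \<open>Invertible frames, definiteness and the Loewner order\<close>

definition inverse_mats :: "nat \<Rightarrow> complex mat \<Rightarrow> complex mat \<Rightarrow> bool" where
  "inverse_mats n T R \<longleftrightarrow> T \<in> carrier_mat n n \<and> R \<in> carrier_mat n n \<and> T * R = 1\<^sub>m n \<and> R * T = 1\<^sub>m n"

lemma inverse_mats_adjoint:
  assumes "inverse_mats n T R"
  shows "inverse_mats n (mat_adjoint T) (mat_adjoint R)"
proof -
  have c: "T \<in> carrier_mat n n" "R \<in> carrier_mat n n" using assms by (auto simp: inverse_mats_def)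
  show ?thesis
    using assms unfolding inverse_mats_def
    by (simp add: mat_adjoint_mult[OF c, symmetric] mat_adjoint_mult[OF c(2,1), symmetric])
qed

lemma inverse_mats_mult:
  assumes "inverse_mats n T R" "inverse_mats n T' R'"
  shows "inverse_mats n (T * T') (R' * R)"
proof -
  have c: "T \<in> carrier_mat n n" "R \<in> carrier_mat n n" "T' \<in> carrier_mat n n" "R' \<in> carrier_mat n n"
    and i: "T * R = 1\<^sub>m n" "R * T = 1\<^sub>m n" "T' * R' = 1\<^sub>m n" "R' * T' = 1\<^sub>m n"
    using assms by (auto simp: inverse_mats_def)
  have "T * T' * (R' * R) = T * ((T' * R') * R)" using c by (simp add: assoc_mult_mat[of _ n n _ n _ n])
  also have "\<dots> = 1\<^sub>m n" using c i by simp
  finally have 1: "T * T' * (R' * R) = 1\<^sub>m n" .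
  have "R' * R * (T * T') = R' * ((R * T) * T')" using c by (simp add: assoc_mult_mat[of _ n n _ n _ n])
  also have "\<dots> = 1\<^sub>m n" using c i by simp
  finally show ?thesis using 1 c by (auto simp: inverse_mats_def)
qed

lemma inverse_mats_diag:
  assumes "\<And>i. i < n \<Longrightarrow> s i \<noteq> 0"
  shows "inverse_mats n (mat_diag n (\<lambda>i. complex_of_real (s i))) (mat_diag n (\<lambda>i. complex_of_real (1 / s i)))"
proof -
  have "mat_diag n (\<lambda>i. complex_of_real (s i) * complex_of_real (1 / s i)) = 1\<^sub>m n"
    "mat_diag n (\<lambda>i. complex_of_real (1 / s i) * complex_of_real (s i)) = 1\<^sub>m n"
    using assms by (auto intro!: eq_matI simp: mat_diag_def)
  then show ?thesis by (simp add: inverse_mats_def del: of_real_divide)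
qed

text \<open>For invertible \<open>T\<close> the coordinate vector
  \<open>mat_adjoint T *\<^sub>v v\<close> ranges over all vectors, so the weighted sum of squares
  is tested on each coordinate separately.\<close>

lemma positive_definite_cdiag:
  assumes TR: "inverse_mats n T R"
  shows "positive_definite n (cdiag n T d) \<longleftrightarrow> (\<forall>i<n. 0 < d i)"
    and "positive_semidefinite (cdiag n T d) \<longleftrightarrow> (\<forall>i<n. 0 \<le> d i)"
proof -
  have T: "T \<in> carrier_mat n n" using TR by (simp add: inverse_mats_def)
  have inv: "mat_adjoint R *\<^sub>v (mat_adjoint T *\<^sub>v v) = v" "mat_adjoint T *\<^sub>v (mat_adjoint R *\<^sub>v v) = v"
    and ad: "mat_adjoint R *\<^sub>v v \<in> carrier_vec n" "mat_adjoint T *\<^sub>v v \<in> carrier_vec n"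
    if v: "v \<in> carrier_vec n" for v
    using inverse_mats_adjoint[OF TR] v
    by (auto simp: inverse_mats_def assoc_mult_mat_vec[of _ n n _ n, symmetric])
  have unit: "\<exists>v\<in>carrier_vec n. v \<noteq> 0\<^sub>v n \<and> (cdiag n T d *\<^sub>v v) \<bullet>c v = complex_of_real (d i)"
    if i: "i < n" for i
  proof (intro bexI conjI)
    \<comment> \<open>The preimage of the unit vector under \<open>mat_adjoint T\<close>: its
      quadratic form isolates \<open>d i\<close>.\<close>
    let ?v = "mat_adjoint R *\<^sub>v unit_vec n i"
    show v: "?v \<in> carrier_vec n" by (simp add: ad)
    have "(cdiag n T d *\<^sub>v ?v) \<bullet>c ?v = complex_of_real (\<Sum>j<n. d j * (cmod ((mat_adjoint T *\<^sub>v ?v) $ j))\<^sup>2)"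
      by (rule cdiag_sprod[OF T v])
    also have "mat_adjoint T *\<^sub>v ?v = unit_vec n i" by (simp add: inv)
    also have "(\<Sum>j<n. d j * (cmod (unit_vec n i $ j :: complex))\<^sup>2) = (\<Sum>j<n. if i = j then d j else 0)"
      using i by (intro sum.cong) auto
    also have "\<dots> = d i" using i by simp
    finally show "(cdiag n T d *\<^sub>v ?v) \<bullet>c ?v = complex_of_real (d i)" .
    show "?v \<noteq> 0\<^sub>v n"
    proof
      assume "?v = 0\<^sub>v n"
      then have "mat_adjoint T *\<^sub>v ?v = 0\<^sub>v n" using T by (auto intro!: eq_vecI)
      then have "unit_vec n i = (0\<^sub>v n :: complex vec)" by (simp add: inv)
      then have "unit_vec n i $ i = (0::complex)" using i by simp
      then show False using i by simp
    qed
  qed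
  have dim: "dim_row (cdiag n T d) = n" using cdiag_carrier[OF T, of d] by auto
  show "positive_definite n (cdiag n T d) \<longleftrightarrow> (\<forall>i<n. 0 < d i)"
  proof
    assume "positive_definite n (cdiag n T d)"
    then show "\<forall>i<n. 0 < d i" using unit unfolding positive_definite_def
      by (metis of_real_0 less_complex_def Re_complex_of_real)
  next
    assume d: "\<forall>i<n. 0 < d i"
    have "0 < (cdiag n T d *\<^sub>v v) \<bullet>c v" if v: "v \<in> carrier_vec n" "v \<noteq> 0\<^sub>v n" for v
    proof -
      let ?w = "mat_adjoint T *\<^sub>v v"
      have "\<exists>i<n. ?w $ i \<noteq> 0"
      proof (rule ccontr)
        assume "\<not> (\<exists>i<n. ?w $ i \<noteq> 0)"
        then have "?w = 0\<^sub>v n" using carrier_vecD[OF ad(2)[OF v(1)]] by (intro eq_vecI) auto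
        then have "mat_adjoint R *\<^sub>v ?w = 0\<^sub>v n" using TR by (auto intro!: eq_vecI simp: inverse_mats_def)
        then show False using inv[OF v(1)] v(2) by simp
      qed
      then obtain i where i: "i < n" "?w $ i \<noteq> 0" by auto
      have "0 < (\<Sum>i<n. d i * (cmod (?w $ i))\<^sup>2)"
        using i d by (intro sum_pos2[of _ i]) (auto simp: less_imp_le)
      then show ?thesis unfolding cdiag_sprod[OF T v(1)]
        by (simp only: less_complex_def Re_complex_of_real Im_complex_of_real zero_complex.sel simp_thms)
    qed
    then show "positive_definite n (cdiag n T d)"
      using T by (simp add: positive_definite_def hermitian_cdiag)
  qed
  show "positive_semidefinite (cdiag n T d) \<longleftrightarrow> (\<forall>i<n. 0 \<le> d i)"
  proof
    assume "positive_semidefinite (cdiag n T d)"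
    then show "\<forall>i<n. 0 \<le> d i" using unit unfolding positive_semidefinite_def dim
      by (metis of_real_0 less_eq_complex_def Re_complex_of_real)
  next
    assume d: "\<forall>i<n. 0 \<le> d i"
    have "0 \<le> (cdiag n T d *\<^sub>v v) \<bullet>c v" if v: "v \<in> carrier_vec n" for v
    proof -
      have "0 \<le> (\<Sum>i<n. d i * (cmod ((mat_adjoint T *\<^sub>v v) $ i))\<^sup>2)"
        using d by (intro sum_nonneg) auto
      then show ?thesis unfolding cdiag_sprod[OF T v]
        by (simp only: less_eq_complex_def Re_complex_of_real Im_complex_of_real zero_complex.sel simp_thms)
    qed
    then show "positive_semidefinite (cdiag n T d)"
      using T by (simp add: positive_semidefinite_def hermitian_cdiag dim)
  qed
qed

text \<open>In a common frame the difference of two matrices is again a \<open>cdiag\<close>, so the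
  order reduces to a comparison of diagonals.\<close>

lemma loewner_le_cdiag:
  assumes "inverse_mats n T R"
  shows "loewner_le (cdiag n T d) (cdiag n T e) \<longleftrightarrow> (\<forall>i<n. d i \<le> e i)"
proof -
  have T: "T \<in> carrier_mat n n" using assms by (simp add: inverse_mats_def)
  show ?thesis
    using carrier_matD[OF cdiag_carrier[OF T]]
    by (simp add: loewner_le_def hermitian_cdiag[OF T] cdiag_diff[OF T] positive_definite_cdiag(2)[OF assms])
qed

text \<open>The quadratic forms of \<open>C - B\<close> and \<open>B - A\<close> add up to that of
  \<open>C - A\<close>. Needed to chain small steps.\<close>

lemma loewner_le_trans:
  assumes "loewner_le A B" "loewner_le B C"
  shows "loewner_le A C"
proof -
  define n where "n = dim_row A"
  have c: "A \<in> carrier_mat n n" "B \<in> carrier_mat n n" "C \<in> carrier_mat n n"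
    using assms by (auto simp: loewner_le_def hermitian_mat_def n_def)
  have "mat_adjoint (C - A) = C - A"
  proof (rule eq_matI)
    fix i j assume "i < dim_row (C - A)" "j < dim_col (C - A)"
    then have ij: "i < n" "j < n" using c by auto
    have "mat_adjoint A = A" "mat_adjoint C = C"
      using assms by (auto simp: loewner_le_def hermitian_mat_def)
    then have "cnj (A $$ (j,i)) = A $$ (i,j)" "cnj (C $$ (j,i)) = C $$ (i,j)"
      using ij c index_mat_adjoint[of i A j] index_mat_adjoint[of i C j] by auto
    then show "mat_adjoint (C - A) $$ (i, j) = (C - A) $$ (i, j)"
      using ij c by auto
  qed (use c in auto)
  moreover have "0 \<le> ((C - A) *\<^sub>v v) \<bullet>c v" if v: "v \<in> carrier_vec n" for v
  proof -
    have "C - A = (C - B) + (B - A)" using c by (intro eq_matI) auto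
    moreover have "C - B \<in> carrier_mat n n" "B - A \<in> carrier_mat n n" using c by auto
    ultimately have "((C - A) *\<^sub>v v) \<bullet>c v = ((C - B) *\<^sub>v v) \<bullet>c v + ((B - A) *\<^sub>v v) \<bullet>c v"
      using v mult_mat_vec_carrier[of _ n n v]
      by (simp add: add_mult_distrib_mat_vec[of _ n n] add_scalar_prod_distrib[of _ n])
    moreover have "0 \<le> ((C - B) *\<^sub>v v) \<bullet>c v" "0 \<le> ((B - A) *\<^sub>v v) \<bullet>c v"
      using assms v c by (auto simp: loewner_le_def positive_semidefinite_def)
    ultimately show ?thesis by simp
  qed
  ultimately show ?thesis using assms c
    by (auto simp: loewner_le_def positive_semidefinite_def hermitian_mat_def)
qed

lemma cdiag_cong:
  assumes "\<And>i. i < n \<Longrightarrow> d i = e i"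
  shows "cdiag n T d = cdiag n T e"
proof -
  have "mat_diag n (\<lambda>i. complex_of_real (d i)) = mat_diag n (\<lambda>i. complex_of_real (e i))"
    using assms by (intro eq_matI) (auto simp: mat_diag_def)
  then show ?thesis by (simp add: cdiag_def)
qed

lemma cdiag_one:
  assumes "T \<in> carrier_mat m n"
  shows "cdiag n T (\<lambda>_. 1) = T * mat_adjoint T"
  using assms by (simp add: cdiag_def)

text \<open>From here on, unitarity of \<open>U\<close> is expressed as
  \<open>inverse_mats n U (mat_adjoint U)\<close>; for square matrices a one-sided inverse is
  enough.\<close>

lemma inverse_mats_adjointI:
  assumes "U \<in> carrier_mat n n" "U * mat_adjoint U = 1\<^sub>m n"
  shows "inverse_mats n U (mat_adjoint U)"
  using assms mat_mult_left_right_inverse[of U n "mat_adjoint U"] by (auto simp: inverse_mats_def)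

lemma diagonalization_cdiag:
  assumes "inverse_mats n U (mat_adjoint U)"
  shows "diagonalization (cdiag n U d) U d"
  using assms by (auto simp: inverse_mats_def diagonalization_def unitary_mat_def cdiag_def)

lemma fun_mat_cdiag:
  assumes "inverse_mats n U (mat_adjoint U)"
  shows "fun_mat f (cdiag n U d) = cdiag n U (\<lambda>i. f (d i))"
  using fun_mat_eq[OF diagonalization_cdiag[OF assms]] assms
  by (auto simp: inverse_mats_def cdiag_def)

subsection \<open>The spectral theorem\<close>

text \<open>Complete \<open>v\<close> to a basis, orthogonalise by Gram-Schmidt, which keeps the
  first vector, and normalise. The factor \<open>c\<close> is the inverse of the norm of
  \<open>v\<close>.\<close>

lemma unitary_first_col:
  fixes v :: "complex vec"
  assumes v: "v \<in> carrier_vec n" "v \<noteq> 0\<^sub>v n"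
  obtains U c where "inverse_mats n U (mat_adjoint U)" "col U 0 = c \<cdot>\<^sub>v v"
proof -
  define b where "b = basis_completion v"
  define ws where "ws = gram_schmidt n b"
  have n: "n \<noteq> 0" using v by (auto intro!: eq_vecI)
  note b = vec_space.basis_completion[OF v, folded b_def]
  note ws_facts = cof_vec_space.gram_schmidt_result[OF b(2,4,5) refl, folded ws_def]
  have ws: "set ws \<subseteq> carrier_vec n" "corthogonal ws" "length ws = n"
    by (fact ws_facts(3), fact ws_facts(2), simp only: ws_facts(4) b(6))
  obtain vs where bv: "b = v # vs" using b(6,7) n by (cases b) auto
  have hd: "hd ws = v"
    unfolding ws_def bv by (rule cof_vec_space.gram_schmidt_hd[OF v(1)])
  then have ws0: "ws ! 0 = v" using ws(3) n by (cases ws) auto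
  have wsc: "ws ! i \<in> carrier_vec n" if "i < n" for i using ws that by auto
  \<comment> \<open>Squared norms: Gram-Schmidt gives only orthogonal vectors, so the columns of
    \<open>U\<close> are divided by \<open>sqrt (r j)\<close>.\<close>
  define r where "r i = Re (ws ! i \<bullet>c ws ! i)" for i
  define U where "U = mat n n (\<lambda>(i, j). complex_of_real (1 / sqrt (r j)) * ws ! j $ i)"
  have U: "U \<in> carrier_mat n n" by (simp add: U_def)
  have orth: "ws ! j \<bullet>c ws ! i = (if i = j then complex_of_real (r i) else 0)"
    and rpos: "0 < r i" if ij: "i < n" "j < n" for i j
  proof -
    have "ws ! i \<bullet>c ws ! i \<noteq> 0" "0 \<le> ws ! i \<bullet>c ws ! i"
      using corthogonalD[OF ws(2), of i i] ij ws(3) wsc[OF ij(1)] by auto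
    then have *: "0 < ws ! i \<bullet>c ws ! i" by simp
    then show "0 < r i" by (simp add: r_def less_complex_def)
    show "ws ! j \<bullet>c ws ! i = (if i = j then complex_of_real (r i) else 0)"
      using corthogonalD[OF ws(2), of j i] ij ws(3) * by (auto simp: r_def less_complex_def complex_eq_iff)
  qed
  have "mat_adjoint U * U = 1\<^sub>m n"
  proof (rule eq_matI)
    fix i j assume "i < dim_row (1\<^sub>m n :: complex mat)" "j < dim_col (1\<^sub>m n :: complex mat)"
    then have ij: "i < n" "j < n" by auto
    have "(mat_adjoint U * U) $$ (i, j) = (\<Sum>k<n. cnj (U $$ (k, i)) * U $$ (k, j))"
      using ij U by (auto simp: scalar_prod_def atLeast0LessThan intro!: sum.cong)
    also have "\<dots> = (\<Sum>k<n. complex_of_real (1 / sqrt (r i) * (1 / sqrt (r j))) * (ws ! j $ k * cnj (ws ! i $ k)))"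
      using ij by (auto simp: U_def mult_ac intro!: sum.cong)
    also have "\<dots> = complex_of_real (1 / sqrt (r i) * (1 / sqrt (r j))) * (ws ! j \<bullet>c ws ! i)"
      using wsc[OF ij(1)] by (auto simp: scalar_prod_def atLeast0LessThan sum_distrib_left intro!: sum.cong)
    also have "\<dots> = (1\<^sub>m n) $$ (i, j)"
    proof (cases "i = j")
      case True
      have "1 / sqrt (r i) * (1 / sqrt (r i)) * r i = 1" using rpos[OF ij(1,1)] by (simp add: field_simps)
      then have "complex_of_real (1 / sqrt (r i) * (1 / sqrt (r i)) * r i) = 1" by simp
      then show ?thesis using ij orth[OF ij] True by (simp del: times_divide_eq_left times_divide_eq_right)
    qed (use ij orth[OF ij] in simp)
    finally show "(mat_adjoint U * U) $$ (i, j) = (1\<^sub>m n) $$ (i, j)" .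
  qed (use U in auto)
  then have "inverse_mats n U (mat_adjoint U)"
    using mat_mult_left_right_inverse[of "mat_adjoint U" n U] U by (auto simp: inverse_mats_def)
  moreover have "col U 0 = complex_of_real (1 / sqrt (r 0)) \<cdot>\<^sub>v v"
    using n v by (intro eq_vecI) (auto simp: U_def ws0)
  ultimately show ?thesis using that by blast
qed

lemma hermitian_index:
  assumes "hermitian_mat A" "A \<in> carrier_mat n n" "i < n" "j < n"
  shows "cnj (A $$ (j, i)) = A $$ (i, j)"
proof -
  have "mat_adjoint A $$ (i, j) = cnj (A $$ (j, i))"
    using assms by (subst index_mat_adjoint) auto
  then show ?thesis using assms(1) by (simp add: hermitian_mat_def)
qed

lemma hermitian_matI:
  assumes "A \<in> carrier_mat n n" "\<And>i j. i < n \<Longrightarrow> j < n \<Longrightarrow> cnj (A $$ (j, i)) = A $$ (i, j)"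
  shows "hermitian_mat A"
  using assms by (auto simp: hermitian_mat_def intro!: eq_matI)

text \<open>Deflation by induction on the dimension: in an orthonormal basis starting with an
  eigenvector, the first column vanishes below the corner, by hermiticity so does the first row, and
  the induction hypothesis diagonalises the remaining block.\<close>

theorem spectral_theorem:
  assumes "A \<in> carrier_mat n n" "hermitian_mat A"
  shows "\<exists>U d. inverse_mats n U (mat_adjoint U) \<and> A = cdiag n U d"
  using assms
proof (induction n arbitrary: A)
  case 0
  have "inverse_mats 0 (1\<^sub>m 0) (mat_adjoint (1\<^sub>m 0))" by (auto simp: inverse_mats_def)
  moreover have "A = cdiag 0 (1\<^sub>m 0) (\<lambda>_. 0)"
    using 0(1) carrier_matD[OF cdiag_carrier[of "1\<^sub>m 0" 0 0 "\<lambda>_. 0"]] by (intro eq_matI) auto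
  ultimately show ?case by blast
next
  case (Suc n)
  note A = Suc.prems(1)
  obtain e where "eigenvalue A e"
    using spectrum_non_empty[OF A] by (auto simp: spectrum_def)
  then obtain v where v: "v \<in> carrier_vec (Suc n)" "v \<noteq> 0\<^sub>v (Suc n)" "A *\<^sub>v v = e \<cdot>\<^sub>v v"
    using A by (auto simp: eigenvalue_def eigenvector_def)
  obtain U c where U: "inverse_mats (Suc n) U (mat_adjoint U)" and col: "col U 0 = c \<cdot>\<^sub>v v"
    using unitary_first_col[OF v(1,2)] .
  then have Uc: "U \<in> carrier_mat (Suc n) (Suc n)" and U1: "U * mat_adjoint U = 1\<^sub>m (Suc n)"
    and U2: "mat_adjoint U * U = 1\<^sub>m (Suc n)" by (auto simp: inverse_mats_def)
  define A' where "A' = mat_adjoint U * A * U"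
  have A': "A' \<in> carrier_mat (Suc n) (Suc n)" unfolding A'_def using Uc A by (intro mult_carrier_mat) auto
  have "mat_adjoint A' = mat_adjoint U * mat_adjoint (mat_adjoint U * A)"
    unfolding A'_def using Uc A by (intro mat_adjoint_mult[of _ "Suc n" "Suc n"] mult_carrier_mat) auto
  also have "mat_adjoint (mat_adjoint U * A) = A * U"
    using Uc A Suc.prems(2) by (subst mat_adjoint_mult[of _ "Suc n" "Suc n"]) (auto simp: hermitian_mat_def)
  also have "mat_adjoint U * (A * U) = A'"
    unfolding A'_def using Uc A by (intro assoc_mult_mat[symmetric]) auto
  finally have herm: "hermitian_mat A'" using A' by (auto simp: hermitian_mat_def)
  note hi = hermitian_index[OF herm A']
  \<comment> \<open>Column 0 of \<open>U\<close> is a multiple of the eigenvector, so column 0 of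
    \<open>A'\<close> is \<open>e\<close> times column 0 of \<open>mat_adjoint U * U\<close>, the
    identity.\<close>
  have A'0: "A' $$ (Suc i, 0) = 0" if i: "i < n" for i
  proof -
    have "A' = mat_adjoint U * (A * U)"
      unfolding A'_def using Uc A by (intro assoc_mult_mat) auto
    then have "A' $$ (Suc i, 0) = row (mat_adjoint U) (Suc i) \<bullet> col (A * U) 0"
      using i Uc A by simp
    also have "col (A * U) 0 = A *\<^sub>v (c \<cdot>\<^sub>v v)"
      using col_mult2[OF A Uc, of 0] by (simp add: col)
    also have "\<dots> = e \<cdot>\<^sub>v col U 0"
      using v A by (simp add: mult_mat_vec[of _ "Suc n" "Suc n"] col smult_smult_assoc mult.commute)
    also have "row (mat_adjoint U) (Suc i) \<bullet> (e \<cdot>\<^sub>v col U 0) = e * (mat_adjoint U * U) $$ (Suc i, 0)"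
      using i Uc by simp
    finally show ?thesis using U2 i by simp
  qed
  have A'0': "A' $$ (0, Suc i) = 0" if i: "i < n" for i
    using hi[of 0 "Suc i"] A'0[OF i] i by simp
  define B where "B = mat n n (\<lambda>(i, j). A' $$ (Suc i, Suc j))"
  have "hermitian_mat B" by (rule hermitian_matI[of _ n]) (auto simp: B_def hi)
  then obtain V d where V: "inverse_mats n V (mat_adjoint V)" and B: "B = cdiag n V d"
    using Suc.IH[of B] by (auto simp: B_def)
  then have Vc: "V \<in> carrier_mat n n" and V1: "cdiag n V (\<lambda>_. 1) = 1\<^sub>m n"
    by (auto simp: inverse_mats_def cdiag_one)
  \<comment> \<open>The block diagonal sum of the scalar 1 and \<open>V\<close>.\<close>
  define W where "W = mat (Suc n) (Suc n)
    (\<lambda>(i, j). if i = 0 \<or> j = 0 then (if i = j then 1 else 0) else V $$ (i - 1, j - 1))"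
  have Wc: "W \<in> carrier_mat (Suc n) (Suc n)" by (simp add: W_def)
  have W: "cdiag (Suc n) W h $$ (i, j) = (if i = 0 \<or> j = 0 then (if i = j then complex_of_real (h 0) else 0)
     else cdiag n V (\<lambda>i. h (Suc i)) $$ (i - 1, j - 1))" if ij: "i < Suc n" "j < Suc n" for h i j
    unfolding cdiag_index[OF Wc ij] sum.lessThan_Suc_shift using ij
    by (auto simp: cdiag_index[OF Vc] W_def intro!: sum.cong)
  have "cdiag (Suc n) W (\<lambda>_. 1) = 1\<^sub>m (Suc n)"
  proof (rule eq_matI)
    fix i j assume "i < dim_row (1\<^sub>m (Suc n) :: complex mat)" "j < dim_col (1\<^sub>m (Suc n) :: complex mat)"
    then show "cdiag (Suc n) W (\<lambda>_. 1) $$ (i, j) = 1\<^sub>m (Suc n) $$ (i, j)"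
      by (auto simp: W V1)
  qed (use cdiag_carrier[OF Wc] in auto)
  then have "inverse_mats (Suc n) W (mat_adjoint W)"
    using Wc by (intro inverse_mats_adjointI) (auto simp: cdiag_one)
  from inverse_mats_mult[OF U this]
  have UW: "inverse_mats (Suc n) (U * W) (mat_adjoint (U * W))"
    using Uc Wc by (simp add: mat_adjoint_mult[of U "Suc n" "Suc n"])
  \<comment> \<open>The eigenvalue at the corner followed by those of \<open>B\<close>. Taking
    \<open>Re\<close> loses nothing: diagonal entries of a Hermitian matrix are real.\<close>
  define h where "h = case_nat (Re (A' $$ (0, 0))) d"
  have h: "h 0 = Re (A' $$ (0, 0))" "(\<lambda>i. h (Suc i)) = d" by (auto simp: h_def)
  have "A' = cdiag (Suc n) W h"
  proof (rule eq_matI)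
    fix i j assume "i < dim_row (cdiag (Suc n) W h)" "j < dim_col (cdiag (Suc n) W h)"
    then have ij: "i < Suc n" "j < Suc n" using cdiag_carrier[OF Wc, of h] by auto
    have 0: "complex_of_real (Re (A' $$ (0, 0))) = A' $$ (0, 0)"
      using hi[of 0 0] by (simp add: complex_eq_iff)
    have "B $$ (i - 1, j - 1) = A' $$ (i, j)" if "i \<noteq> 0" "j \<noteq> 0"
      using ij that by (simp add: B_def)
    then show "A' $$ (i, j) = cdiag (Suc n) W h $$ (i, j)"
      using ij A'0[of "i - 1"] A'0'[of "j - 1"] by (auto simp: W h 0 B[symmetric])
  qed (use carrier_matD[OF A'] carrier_matD[OF cdiag_carrier[OF Wc, of h]] in auto)
  then have "cdiag (Suc n) (U * W) h = U * A' * mat_adjoint U"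
    using Uc Wc by (simp add: cdiag_congruence)
  also have "\<dots> = (U * mat_adjoint U) * A * (U * mat_adjoint U)"
    unfolding A'_def using Uc A by (simp add: assoc_mult_mat[of _ "Suc n" "Suc n" _ "Suc n" _ "Suc n"]
        mult_carrier_mat[of _ "Suc n" "Suc n" _ "Suc n"])
  also have "\<dots> = A" using A by (simp add: U1)
  finally show ?case using UW by metis
qed

lemma spectral_positive_definite:
  assumes "positive_definite n A"
  obtains U a where "inverse_mats n U (mat_adjoint U)" "A = cdiag n U a" "\<And>i. i < n \<Longrightarrow> 0 < a i"
  using assms spectral_theorem[of A n] positive_definite_cdiag(1)
  unfolding positive_definite_def[of n A] by (metis assms)

text \<open>\<open>S\<close> and \<open>R\<close> are the powers 1/2 and -1/2 of the matrix, in the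
  form in which \<open>op_mean\<close> uses them. For unitary \<open>U\<close> the inner factor
  \<open>mat_adjoint U * U\<close> cancels, so products of \<open>cdiag\<close> multiply the
  diagonals.\<close>

lemma cdiag_roots:
  assumes U: "inverse_mats n U (mat_adjoint U)" and a: "\<And>i. i < n \<Longrightarrow> 0 < a i"
  defines "S \<equiv> cdiag n U (\<lambda>i. a i powr (1/2))" and "R \<equiv> cdiag n U (\<lambda>i. a i powr (-1/2))"
  shows "inverse_mats n S R" "S * S = cdiag n U a"
proof -
  have Uc: "U \<in> carrier_mat n n" and U': "mat_adjoint U * U = 1\<^sub>m n" "U * mat_adjoint U = 1\<^sub>m n"
    using U by (auto simp: inverse_mats_def)
  have mult: "cdiag n U d * cdiag n U e = cdiag n U (\<lambda>i. d i * e i)" for d e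
  proof -
    let ?D = "\<lambda>d. mat_diag n (\<lambda>i. complex_of_real (d i))"
    have "cdiag n U d * cdiag n U e = U * ?D d * ((mat_adjoint U * U) * (?D e * mat_adjoint U))"
      using Uc by (simp add: cdiag_def assoc_mult_mat[of _ n n _ n _ n] mult_carrier_mat[of _ n n _ n])
    also have "\<dots> = U * (?D d * ?D e) * mat_adjoint U"
      using Uc
      by (simp add: U' left_mult_one_mat[of _ n n] assoc_mult_mat[of _ n n _ n _ n]
          mult_carrier_mat[of _ n n _ n] del: mat_diag_diag)
    finally show ?thesis by (simp add: cdiag_def)
  qed
  have "a i powr (1/2) * a i powr (-1/2) = 1" "a i powr (-1/2) * a i powr (1/2) = 1"
    "a i powr (1/2) * a i powr (1/2) = a i" if "i < n" for i
    using a[OF that] by (simp_all add: powr_add[symmetric])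
  then have "S * R = cdiag n U (\<lambda>_. 1)" "R * S = cdiag n U (\<lambda>_. 1)" "S * S = cdiag n U a"
    unfolding S_def R_def mult by (auto intro!: cdiag_cong)
  then show "inverse_mats n S R" "S * S = cdiag n U a"
    using Uc by (auto simp: inverse_mats_def S_def R_def cdiag_one U')
qed

subsection \<open>Operator means under congruence\<close>

text \<open>Polar decomposition \<open>T = S * V\<close>, with \<open>S\<close> the square root of
  \<open>T * mat_adjoint T\<close>: the inner congruence by \<open>R\<close> turns the frame
  \<open>T\<close> into the unitary \<open>V\<close>, and the outer one by \<open>S\<close> restores
  \<open>T\<close>.\<close>

lemma op_mean_cdiag:
  assumes TR: "inverse_mats n T R'"
  shows "op_mean f (cdiag n T (\<lambda>_. 1)) (cdiag n T b) = cdiag n T (\<lambda>i. f (b i))"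
proof -
  have T: "T \<in> carrier_mat n n" using TR by (simp add: inverse_mats_def)
  have "positive_definite n (cdiag n T (\<lambda>_. 1))" by (simp add: positive_definite_cdiag(1)[OF TR])
  then obtain U a where U: "inverse_mats n U (mat_adjoint U)" and A: "cdiag n T (\<lambda>_. 1) = cdiag n U a"
    and a: "\<And>i. i < n \<Longrightarrow> 0 < a i" by (rule spectral_positive_definite) blast
  define S where "S = cdiag n U (\<lambda>i. a i powr (1/2))"
  define R where "R = cdiag n U (\<lambda>i. a i powr (-1/2))"
  have Uc: "U \<in> carrier_mat n n" using U by (simp add: inverse_mats_def)
  have SR: "inverse_mats n S R" and SS: "S * S = cdiag n U a"
    unfolding S_def R_def by (rule cdiag_roots[OF U a]; simp)+
  have adj: "mat_adjoint S = S" "mat_adjoint R = R" using Uc by (auto simp: S_def R_def cdiag_adjoint)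
  have S: "S \<in> carrier_mat n n" and R: "R \<in> carrier_mat n n" and inv: "S * R = 1\<^sub>m n" "R * S = 1\<^sub>m n"
    using SR by (auto simp: inverse_mats_def)
  \<comment> \<open>\<open>A = T T\<^sup>*\<close> makes \<open>A\<^sup>-\<^sup>1\<^sup>/\<^sup>2 T\<close> unitary, so that the functional calculus commutes with it.\<close>
  define V where "V = R * T"
  have V: "V \<in> carrier_mat n n" using R T by (simp add: V_def)
  have "V * mat_adjoint V = cdiag n V (\<lambda>_. 1)" using V by (simp add: cdiag_one)
  also have "\<dots> = R * (S * S) * R"
    unfolding V_def using cdiag_congruence[OF R T, of "\<lambda>_. 1"] by (simp add: adj A SS)
  also have "\<dots> = (R * S) * (S * R)" using R S by (simp add: assoc_mult_mat[of _ n n _ n _ n])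
  finally have V_un: "inverse_mats n V (mat_adjoint V)"
    using V by (intro inverse_mats_adjointI) (simp_all add: inv)
  have SV: "S * V = T"
    unfolding V_def using S R T by (simp add: assoc_mult_mat[of _ n n _ n _ n, symmetric] inv)
  have "op_mean f (cdiag n T (\<lambda>_. 1)) (cdiag n T b) = S * fun_mat f (R * cdiag n T b * R) * S"
    by (simp add: op_mean_def Let_def A fun_mat_cdiag[OF U] S_def R_def)
  also have "R * cdiag n T b * R = cdiag n V b"
    using cdiag_congruence[OF R T, of b] by (simp add: adj V_def)
  also have "S * fun_mat f (cdiag n V b) * S = cdiag n T (\<lambda>i. f (b i))"
    using cdiag_congruence[OF S V] by (simp add: fun_mat_cdiag[OF V_un] adj SV)
  finally show ?thesis .
qed

text \<open>With \<open>S\<close> the square root of \<open>X\<close> and \<open>R\<close> its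
  inverse, diagonalise \<open>R * Y * R\<close> by a unitary \<open>V\<close>; then
  \<open>S * V\<close> is a frame for both matrices.\<close>

lemma simultaneous_diagonalization:
  assumes "positive_definite n X" "positive_definite n Y"
  obtains T R d where "inverse_mats n T R" "X = cdiag n T (\<lambda>_. 1)" "Y = cdiag n T d"
proof -
  obtain U a where U: "inverse_mats n U (mat_adjoint U)" and X: "X = cdiag n U a"
    and a: "\<And>i. i < n \<Longrightarrow> 0 < a i" using spectral_positive_definite[OF assms(1)] by metis
  obtain U' b where "inverse_mats n U' (mat_adjoint U')" and Y: "Y = cdiag n U' b"
    using spectral_positive_definite[OF assms(2)] by metis
  then have Uc: "U \<in> carrier_mat n n" and Uc': "U' \<in> carrier_mat n n"
    using U by (simp_all add: inverse_mats_def)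
  define S where "S = cdiag n U (\<lambda>i. a i powr (1/2))"
  define R where "R = cdiag n U (\<lambda>i. a i powr (-1/2))"
  have SR: "inverse_mats n S R" and SS: "S * S = X"
    unfolding S_def R_def X by (rule cdiag_roots[OF U a]; simp)+
  have adj: "mat_adjoint S = S" "mat_adjoint R = R" using Uc by (auto simp: S_def R_def cdiag_adjoint)
  have S: "S \<in> carrier_mat n n" and R: "R \<in> carrier_mat n n" and inv: "S * R = 1\<^sub>m n" "R * S = 1\<^sub>m n"
    using SR by (auto simp: inverse_mats_def)
  have Yc: "Y \<in> carrier_mat n n" using Y Uc' by simp
  have "R * Y * R = cdiag n (R * U') b" using cdiag_congruence[OF R Uc', of b] by (simp add: Y adj)
  moreover have "R * U' \<in> carrier_mat n n" using R Uc' by simp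
  ultimately obtain V d where V: "inverse_mats n V (mat_adjoint V)" and D: "R * Y * R = cdiag n V d"
    using spectral_theorem[of "R * Y * R" n] by (metis cdiag_carrier hermitian_cdiag)
  have Vc: "V \<in> carrier_mat n n" and V1: "cdiag n V (\<lambda>_. 1) = 1\<^sub>m n"
    using V cdiag_one[of V n n] by (simp_all add: inverse_mats_def)
  note cong = cdiag_congruence[OF S Vc, symmetric, unfolded adj]
  show ?thesis
  proof (rule that)
    show "inverse_mats n (S * V) (mat_adjoint V * R)" by (rule inverse_mats_mult[OF SR V])
    show "X = cdiag n (S * V) (\<lambda>_. 1)" using S by (simp add: cong V1 SS)
    have "cdiag n (S * V) d = (S * R) * Y * (R * S)"
      using S R Yc by (simp add: cong D[symmetric] assoc_mult_mat[of _ n n _ n _ n] del: inv)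
    then show "Y = cdiag n (S * V) d" using Yc by (simp add: inv)
  qed
qed

lemma op_mean_cdiag_positive:
  assumes T: "inverse_mats n T R" and e: "\<And>i. i < n \<Longrightarrow> 0 < e i"
  shows "op_mean f (cdiag n T e) (cdiag n T b) = cdiag n T (\<lambda>i. e i * f (b i / e i))"
proof -
  \<comment> \<open>Absorbs \<open>e\<close> into the frame, so that the first argument has diagonal
    1 with respect to \<open>T'\<close>.\<close>
  define T' where "T' = T * mat_diag n (\<lambda>i. complex_of_real (sqrt (e i)))"
  have T': "inverse_mats n T' (mat_diag n (\<lambda>i. complex_of_real (1 / sqrt (e i))) * R)"
    unfolding T'_def using T inverse_mats_diag[of n "\<lambda>i. sqrt (e i)"] e
    by (intro inverse_mats_mult) force+
  have scale: "cdiag n T h = cdiag n T' (\<lambda>i. h i / e i)" for h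
  proof -
    have "cdiag n T' (\<lambda>i. h i / e i) = cdiag n T (\<lambda>i. h i / e i * (sqrt (e i))\<^sup>2)"
      unfolding T'_def using T by (intro cdiag_scale) (auto simp: inverse_mats_def)
    also have "\<dots> = cdiag n T h"
    proof (rule cdiag_cong)
      fix i assume "i < n"
      then show "h i / e i * (sqrt (e i))\<^sup>2 = h i" using e[of i] by simp
    qed
    finally show ?thesis ..
  qed
  have "cdiag n T e = cdiag n T' (\<lambda>_. 1)"
    unfolding scale[of e] using e by (intro cdiag_cong) force
  moreover have "cdiag n T (\<lambda>i. e i * f (b i / e i)) = cdiag n T' (\<lambda>i. f (b i / e i))"
    unfolding scale[of "\<lambda>i. e i * f (b i / e i)"] using e by (intro cdiag_cong) force
  ultimately show ?thesis using op_mean_cdiag[OF T', of f] by (simp add: scale[of b])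
qed

subsection \<open>Operator monotonicity\<close>

text \<open>In a common frame \<open>Y\<close> arises from \<open>X\<close> by finitely many ratios
  \<open>d i\<close>, all bounded by some power of \<open>c\<close>; each ratio is split into
  factors between 1 and \<open>c\<close>, and the resulting inequalities are chained.\<close>

lemma operator_monotone_by_small_steps:
  assumes c: "1 < c"
    and step: "\<And>n T R e q. inverse_mats n T R \<Longrightarrow> (\<And>i. i < n \<Longrightarrow> 0 < e i) \<Longrightarrow>
      (\<And>i. i < n \<Longrightarrow> 1 \<le> q i \<and> q i \<le> c) \<Longrightarrow>
      loewner_le (fun_mat g (cdiag n T e)) (fun_mat g (cdiag n T (\<lambda>i. e i * q i)))"
  shows "operator_monotone g"
  unfolding operator_monotone_def
proof (intro allI impI, elim conjE)
  fix n X Y assume X: "positive_definite n X" and Y: "positive_definite n Y" and le: "loewner_le X Y"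
  obtain T R d where T: "inverse_mats n T R" and XT: "X = cdiag n T (\<lambda>_. 1)" and YT: "Y = cdiag n T d"
    using simultaneous_diagonalization[OF X Y] .
  have d: "1 \<le> d i" if "i < n" for i using le that by (simp add: XT YT loewner_le_cdiag[OF T])
  have chain: "loewner_le (fun_mat g (cdiag n T e)) (fun_mat g (cdiag n T (\<lambda>i. e i * d i)))"
    if "\<And>i. i < n \<Longrightarrow> 0 < e i" "\<And>i. i < n \<Longrightarrow> 1 \<le> d i \<and> d i \<le> c ^ m" for m e d
    using that
  proof (induction m arbitrary: e d)
    case 0
    \<comment> \<open>Here all \<open>d i\<close> are 1. The step hypothesis is still applied, since
      it supplies reflexivity together with the hermiticity contained in
      \<open>loewner_le\<close>.\<close>
    then show ?case using c by (intro step[OF T]) force+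
  next
    case (Suc m)
    \<comment> \<open>Ratios are cut off at \<open>c\<close>: the remaining ratio
      \<open>d i / q i\<close> is 1 if \<open>d i\<close> is at most \<open>c\<close>, and
      \<open>d i / c\<close> otherwise.\<close>
    define q where "q i = min (d i) c" for i
    have q: "1 \<le> q i \<and> q i \<le> c" and dq: "1 \<le> d i / q i \<and> d i / q i \<le> c ^ m" if "i < n" for i
      using Suc.prems(2)[OF that] c one_le_power[of c m] by (auto simp: q_def min_def field_simps)
    have 1: "loewner_le (fun_mat g (cdiag n T e)) (fun_mat g (cdiag n T (\<lambda>i. e i * q i)))"
      using Suc.prems(1) q by (intro step[OF T]) auto
    have 2: "loewner_le (fun_mat g (cdiag n T (\<lambda>i. e i * q i)))
        (fun_mat g (cdiag n T (\<lambda>i. e i * q i * (d i / q i))))"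
      using Suc.prems(1) q dq by (intro Suc.IH) (force intro!: mult_pos_pos)+
    have 3: "cdiag n T (\<lambda>i. e i * q i * (d i / q i)) = cdiag n T (\<lambda>i. e i * d i)"
      using q by (intro cdiag_cong) force
    show ?case using loewner_le_trans[OF 1 2] unfolding 3 .
  qed
  \<comment> \<open>Inserting 1 keeps the set nonempty when \<open>n = 0\<close>.\<close>
  obtain m where m: "Max (insert 1 (d ` {..<n})) < c ^ m" using real_arch_pow[OF c] by blast
  have "d i \<le> c ^ m" if "i < n" for i
    using m that by (auto intro: less_imp_le)
  then show "loewner_le (fun_mat g X) (fun_mat g Y)"
    using chain[of "\<lambda>_. 1" d m] d by (simp add: XT YT)
qed

section \<open>Scalar consequences: monotonicity, symmetry and the range of
  \<open>f t / sqrt t\<close>\<close>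

lemma inverse_mats_one: "inverse_mats n (1\<^sub>m n) (1\<^sub>m n)"
  by (auto simp: inverse_mats_def)

lemma operator_monotone_imp_mono:
  assumes "operator_monotone f" "0 < s" "s \<le> t"
  shows "f s \<le> f t"
proof -
  let ?M = "\<lambda>t. cdiag 1 (1\<^sub>m 1) (\<lambda>_. t)"
  note one = inverse_mats_one[of 1]
  have "loewner_le (fun_mat f (?M s)) (fun_mat f (?M t))"
    using assms unfolding operator_monotone_def
    by (metis loewner_le_cdiag[OF one] positive_definite_cdiag(1)[OF one] order_less_le_trans)
  then show ?thesis using one
    by (simp add: fun_mat_cdiag loewner_le_cdiag[OF one] del: One_nat_def)
qed

text \<open>This is the mean \<open>A \<tau> B = B\<close>. Its \<open>perp_fun\<close> is 1 on the
  positive half-line, hence the mean \<open>A\<close>, so that inserting this pair swaps the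
  arguments of \<sigma>.\<close>

lemma representing_function_id: "representing_function (\<lambda>t. t)"
proof -
  have "fun_mat (\<lambda>t. t) X = X" if "positive_definite n X" for n X
    by (rule spectral_positive_definite[OF that]) (simp add: fun_mat_cdiag)
  then have "operator_monotone (\<lambda>t. t)" unfolding operator_monotone_def by metis
  then show ?thesis by (simp add: representing_function_def)
qed

text \<open>The intermediate value theorem for \<open>f t / sqrt t\<close> between
  \<open>t = 1\<close>, where it equals 1, and \<open>t = x\<close>. The disjunction allows its
  value at \<open>x\<close> to lie on either side of 1, which serves both parts of the
  theorem.\<close>

lemma ratio_sqrt_surj:
  fixes f :: "real \<Rightarrow> real"
  assumes f: "representing_function f" and sym: "\<And>t. 0 < t \<Longrightarrow> f t = t * f (1 / t)"
    and x: "0 < x" and q: "0 < q" "(1 \<le> q \<and> q * sqrt x \<le> f x) \<or> (q \<le> 1 \<and> f x \<le> q * sqrt x)"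
  shows "\<exists>b>0. f b = q * sqrt b"
proof -
  have pos: "0 < f t" if "0 < t" for t using f that by (simp add: representing_function_def)
  have mono: "f s \<le> f t" if "0 < s" "s \<le> t" for s t
    using f that by (auto simp: representing_function_def intro: operator_monotone_imp_mono)
  define F where "F u = ln (f (exp u))" for u
  \<comment> \<open>\<open>f(t)\<close> increases and \<open>f(t)/t = f(1/t)\<close> decreases, which makes \<open>F\<close> 1-Lipschitz.\<close>
  have F: "F u \<le> F v" "F v \<le> F u + (v - u)" if "u \<le> v" for u v
  proof -
    show "F u \<le> F v" using that pos mono by (simp add: F_def)
    have "f (1 / exp v) \<le> f (1 / exp u)" using that by (intro mono) (auto simp: field_simps)
    then have "ln (f (1 / exp v)) \<le> ln (f (1 / exp u))" using pos by simp
    moreover have "F w = w + ln (f (1 / exp w))" for w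
      using sym[of "exp w"] pos[of "1 / exp w"] by (simp add: F_def ln_mult)
    ultimately show "F v \<le> F u + (v - u)" by simp
  qed
  have cont: "isCont F u" for u
    unfolding isCont_def
  proof (rule metric_LIM_I)
    fix r :: real assume "0 < r"
    moreover have "dist (F v) (F u) \<le> dist v u" for v
      using F[of u v] F[of v u] by (cases "u \<le> v") (auto simp: dist_real_def)
    ultimately show "\<exists>s>0. \<forall>v. v \<noteq> u \<and> dist v u < s \<longrightarrow> dist (F v) (F u) < r"
      by (meson order_le_less_trans)
  qed
  \<comment> \<open>The logarithm of \<open>f t / sqrt t\<close> at
    \<open>t = exp u\<close>.\<close>
  define G where "G u = F u - u / 2" for u
  have G: "continuous_on S G" for S
    unfolding G_def by (intro continuous_at_imp_continuous_on ballI continuous_intros cont) simp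
  have G0: "G 0 = 0" using f by (simp add: G_def F_def representing_function_def)
  have Gx: "G (ln x) = ln (f x) - ln (sqrt x)" using x by (simp add: G_def F_def ln_sqrt)
  have lnq: "ln q + ln (sqrt x) = ln (q * sqrt x)" using x q by (simp add: ln_mult)
  have "\<exists>u. G u = ln q"
    using q(2)
  proof
    assume *: "1 \<le> q \<and> q * sqrt x \<le> f x"
    then have "ln (q * sqrt x) \<le> ln (f x)" using x q pos by simp
    then have "G 0 \<le> ln q" "ln q \<le> G (ln x)" using * lnq by (auto simp: G0 Gx)
    then show ?thesis
      \<comment> \<open>The sign of \<open>ln x\<close> decides which endpoint comes first, hence
        the increasing or the decreasing version of the theorem.\<close>
      using IVT'[of G 0 "ln q" "ln x", OF _ _ _ G] IVT2'[of G 0 "ln q" "ln x", OF _ _ _ G]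
      by (cases "0 \<le> ln x") auto
  next
    assume *: "q \<le> 1 \<and> f x \<le> q * sqrt x"
    then have "ln (f x) \<le> ln (q * sqrt x)" using x q pos by simp
    then have "G (ln x) \<le> ln q" "ln q \<le> G 0" using * lnq q(1) by (auto simp: G0 Gx)
    then show ?thesis
      using IVT'[of G "ln x" "ln q" 0, OF _ _ _ G] IVT2'[of G "ln x" "ln q" 0, OF _ _ _ G]
      by (cases "0 \<le> ln x") auto
  qed
  then obtain u where u: "G u = ln q" by blast
  have sqrt_exp: "sqrt (exp u) = exp (u / 2)"
    by (rule real_sqrt_unique) (simp_all add: exp_double[symmetric])
  have "f (exp u) = exp (F u)" using pos by (simp add: F_def)
  also have "\<dots> = exp (ln q + u / 2)" using u by (simp add: G_def)
  also have "\<dots> = q * sqrt (exp u)" using q(1) by (simp add: exp_add sqrt_exp)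
  finally show ?thesis by (intro exI[of _ "exp u"]) simp
qed

lemma positive_definite_scalar: "0 < t \<Longrightarrow> positive_definite 1 (cdiag 1 (1\<^sub>m 1) (\<lambda>_. t))"
  using positive_definite_cdiag(1)[OF inverse_mats_one, of 1 "\<lambda>_. t"] by simp

text \<open>The dimension is written \<open>Suc 0\<close> because the simplifier rewrites \<open>1 :: nat\<close> to it.\<close>

lemma loewner_le_scalar:
  "loewner_le (cdiag (Suc 0) (1\<^sub>m (Suc 0)) (\<lambda>_. s)) (cdiag (Suc 0) (1\<^sub>m (Suc 0)) (\<lambda>_. t)) \<longleftrightarrow> s \<le> t"
  using loewner_le_cdiag[OF inverse_mats_one] by simp

text \<open>For \<open>k\<close> the identity and the scalars 1 and \<open>t\<close> the hypothesis
  reads \<open>t * f (1 / t) \<le> f t\<close>; replacing \<open>t\<close> by \<open>1 / t\<close>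
  gives the reverse inequality.\<close>

lemma transpose_eq_if_perp_le:
  assumes perp: "\<And>k n A B. representing_function k \<Longrightarrow> positive_definite n A \<Longrightarrow> positive_definite n B \<Longrightarrow>
      loewner_le (op_mean f (op_mean k A B) (op_mean (perp_fun k) A B)) (op_mean f A B)"
    and t: "0 < t"
  shows "f t = t * f (1 / t)"
proof -
  have le: "t * f (1 / t) \<le> f t" if "0 < t" for t
    using perp[OF representing_function_id positive_definite_scalar positive_definite_scalar, of 1 t] that
    by (simp add: perp_fun_def op_mean_cdiag_positive[OF inverse_mats_one] loewner_le_scalar)
  from le[of t] le[of "1 / t"] t show ?thesis by (simp add: field_simps)
qed

text \<open>The same substitution with the inequality reversed again yields equality.\<close>

lemma transpose_eq_if_perp_ge:
  assumes perp: "\<And>k n A B. representing_function k \<Longrightarrow> positive_definite n A \<Longrightarrow> positive_definite n B \<Longrightarrow>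
      loewner_le (op_mean f A B) (op_mean f (op_mean k A B) (op_mean (perp_fun k) A B))"
    and t: "0 < t"
  shows "f t = t * f (1 / t)"
proof -
  have le: "f t \<le> t * f (1 / t)" if "0 < t" for t
    using perp[OF representing_function_id positive_definite_scalar positive_definite_scalar, of 1 t] that
    by (simp add: perp_fun_def op_mean_cdiag_positive[OF inverse_mats_one] loewner_le_scalar)
  from le[of t] le[of "1 / t"] t show ?thesis by (simp add: field_simps)
qed

text \<open>Solves for the arguments when both means are prescribed: the ratio \<open>q i\<close> of
  the two means determines \<open>b i\<close>, the quotient of the diagonals of \<open>B\<close> and
  \<open>A\<close>.\<close>

lemma means_realize_ratio:
  assumes f: "representing_function f" and sym: "\<And>t. 0 < t \<Longrightarrow> f t = t * f (1 / t)" and x: "0 < x"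
    and T: "inverse_mats n T R" and e: "\<And>i. i < n \<Longrightarrow> 0 < e i"
    and q: "\<And>i. i < n \<Longrightarrow> 0 < q i \<and>
      (1 \<le> q i \<and> q i * sqrt x \<le> f x \<or> q i \<le> 1 \<and> f x \<le> q i * sqrt x)"
  shows "\<exists>A B. positive_definite n A \<and> positive_definite n B \<and>
    geometric_mean A B = cdiag n T e \<and> op_mean f A B = cdiag n T (\<lambda>i. e i * q i)"
proof -
  have "\<exists>b>0. f b = q i * sqrt b" if "i < n" for i
    using q[OF that] by (intro ratio_sqrt_surj[OF f sym x]) auto
  then obtain b where b: "\<And>i. i < n \<Longrightarrow> 0 < b i \<and> f (b i) = q i * sqrt (b i)" by metis
  \<comment> \<open>The diagonals of \<open>A\<close> and \<open>B\<close> have product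
    \<open>e i\<close> squared, which fixes the geometric mean, and quotient
    \<open>b i\<close>.\<close>
  define A where "A = cdiag n T (\<lambda>i. e i / sqrt (b i))"
  define B where "B = cdiag n T (\<lambda>i. e i * sqrt (b i))"
  have quot: "e i * sqrt (b i) / (e i / sqrt (b i)) = b i" if "i < n" for i
    using e[OF that] b[OF that] by (simp add: field_simps)
  have mean: "op_mean h A B = cdiag n T (\<lambda>i. e i / sqrt (b i) * h (b i))" for h
  proof -
    have "op_mean h A B = cdiag n T (\<lambda>i. e i / sqrt (b i) * h (e i * sqrt (b i) / (e i / sqrt (b i))))"
      unfolding A_def B_def using e b by (intro op_mean_cdiag_positive[OF T]) auto
    also have "\<dots> = cdiag n T (\<lambda>i. e i / sqrt (b i) * h (b i))"
      by (intro cdiag_cong) (simp only: quot)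
    finally show ?thesis .
  qed
  show ?thesis
  proof (intro exI conjI)
    show "positive_definite n A" "positive_definite n B"
      using e b by (simp_all add: A_def B_def positive_definite_cdiag(1)[OF T])
    show "geometric_mean A B = cdiag n T e"
      unfolding geometric_mean_def mean using b by (intro cdiag_cong) force
    show "op_mean f A B = cdiag n T (\<lambda>i. e i * q i)"
      unfolding mean using b by (intro cdiag_cong) force
  qed
qed

text \<open>Small steps with \<open>c = f x / sqrt x\<close>: the smaller matrix is realised as the
  geometric mean and the larger one as the \<sigma>-mean.\<close>

lemma operator_monotone_if_geometric_le:
  assumes f: "representing_function f" and sym: "\<And>t. 0 < t \<Longrightarrow> f t = t * f (1 / t)"
    and x: "0 < x" "sqrt x < f x"
    and g: "\<And>n A B. positive_definite n A \<Longrightarrow> positive_definite n B \<Longrightarrow>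
      loewner_le (fun_mat g (geometric_mean A B)) (fun_mat g (op_mean f A B))"
  shows "operator_monotone g"
proof (rule operator_monotone_by_small_steps)
  show "1 < f x / sqrt x" using x by simp
  fix n T R and e q :: "nat \<Rightarrow> real"
  assume T: "inverse_mats n T R" and e: "\<And>i. i < n \<Longrightarrow> 0 < e i"
    and q: "\<And>i. i < n \<Longrightarrow> 1 \<le> q i \<and> q i \<le> f x / sqrt x"
  have q': "0 < q i \<and> (1 \<le> q i \<and> q i * sqrt x \<le> f x \<or> q i \<le> 1 \<and> f x \<le> q i * sqrt x)"
    if "i < n" for i
    using q[OF that] x by (auto simp: field_simps)
  have "\<exists>A B. positive_definite n A \<and> positive_definite n B \<and>
      geometric_mean A B = cdiag n T e \<and> op_mean f A B = cdiag n T (\<lambda>i. e i * q i)"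
    by (rule means_realize_ratio) (use f sym x(1) T e q' in blast)+
  then show "loewner_le (fun_mat g (cdiag n T e)) (fun_mat g (cdiag n T (\<lambda>i. e i * q i)))"
    using g by metis
qed

text \<open>The roles are exchanged: the geometric mean is now the larger matrix, so the means are
  realised with base \<open>e i * q i\<close> and ratio \<open>1 / q i\<close>, at most 1.\<close>

lemma operator_monotone_if_geometric_ge:
  assumes f: "representing_function f" and sym: "\<And>t. 0 < t \<Longrightarrow> f t = t * f (1 / t)"
    and x: "0 < x" "f x < sqrt x"
    and g: "\<And>n A B. positive_definite n A \<Longrightarrow> positive_definite n B \<Longrightarrow>
      loewner_le (fun_mat g (op_mean f A B)) (fun_mat g (geometric_mean A B))"
  shows "operator_monotone g"
proof (rule operator_monotone_by_small_steps)
  have fx: "0 < f x" using f x by (simp add: representing_function_def)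
  show "1 < sqrt x / f x" using x fx by simp
  fix n T R and e q :: "nat \<Rightarrow> real"
  assume T: "inverse_mats n T R" and e: "\<And>i. i < n \<Longrightarrow> 0 < e i"
    and q: "\<And>i. i < n \<Longrightarrow> 1 \<le> q i \<and> q i \<le> sqrt x / f x"
  have eq: "0 < e i * q i" if "i < n" for i using e[OF that] q[OF that] by (simp add: mult_pos_pos)
  have q': "0 < 1 / q i \<and> (1 \<le> 1 / q i \<and> 1 / q i * sqrt x \<le> f x \<or> 1 / q i \<le> 1 \<and> f x \<le> 1 / q i * sqrt x)"
    if "i < n" for i
    using q[OF that] x fx by (auto simp: field_simps)
  have "\<exists>A B. positive_definite n A \<and> positive_definite n B \<and>
      geometric_mean A B = cdiag n T (\<lambda>i. e i * q i) \<and>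
      op_mean f A B = cdiag n T (\<lambda>i. e i * q i * (1 / q i))"
    by (rule means_realize_ratio) (use f sym x(1) T eq q' in blast)+
  moreover have "cdiag n T (\<lambda>i. e i * q i * (1 / q i)) = cdiag n T e"
    using q by (intro cdiag_cong) force
  ultimately show "loewner_le (fun_mat g (cdiag n T e)) (fun_mat g (cdiag n T (\<lambda>i. e i * q i)))"
    using g by metis
qed

theorem theorem13:
  fixes f g :: "real \<Rightarrow> real"
  assumes "representing_function f"
  shows "((\<forall>k. representing_function k \<longrightarrow>
            (\<forall>n A B. positive_definite n A \<and> positive_definite n B \<longrightarrow>
               loewner_le (op_mean f (op_mean k A B) (op_mean (perp_fun k) A B))
                          (op_mean f A B))) \<and>
         (\<exists>x>1. f x > sqrt x) \<and>
         (\<forall>n A B. positive_definite n A \<and> positive_definite n B \<longrightarrow>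
            loewner_le (fun_mat g (geometric_mean A B)) (fun_mat g (op_mean f A B)))
         \<longrightarrow> operator_monotone g)
       \<and> ((\<forall>k. representing_function k \<longrightarrow>
            (\<forall>n A B. positive_definite n A \<and> positive_definite n B \<longrightarrow>
               loewner_le (op_mean f A B)
                          (op_mean f (op_mean k A B) (op_mean (perp_fun k) A B)))) \<and>
         (\<exists>x. 0 < x \<and> x < 1 \<and> f x < sqrt x) \<and>
         (\<forall>n A B. positive_definite n A \<and> positive_definite n B \<longrightarrow>
            loewner_le (fun_mat g (op_mean f A B)) (fun_mat g (geometric_mean A B)))
         \<longrightarrow> operator_monotone g)"
proof (intro conjI impI; elim conjE exE)
  fix x :: real
  assume perp: "\<forall>k. representing_function k \<longrightarrow>
            (\<forall>n A B. positive_definite n A \<and> positive_definite n B \<longrightarrow>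
               loewner_le (op_mean f (op_mean k A B) (op_mean (perp_fun k) A B)) (op_mean f A B))"
    and x: "1 < x" "f x > sqrt x"
    and g: "\<forall>n A B. positive_definite n A \<and> positive_definite n B \<longrightarrow>
            loewner_le (fun_mat g (geometric_mean A B)) (fun_mat g (op_mean f A B))"
  show "operator_monotone g"
    using operator_monotone_if_geometric_le[OF assms transpose_eq_if_perp_le, of x] perp x g by simp
next
  fix x :: real
  assume perp: "\<forall>k. representing_function k \<longrightarrow>
            (\<forall>n A B. positive_definite n A \<and> positive_definite n B \<longrightarrow>
               loewner_le (op_mean f A B) (op_mean f (op_mean k A B) (op_mean (perp_fun k) A B)))"
    and x: "0 < x" "f x < sqrt x"
    and g: "\<forall>n A B. positive_definite n A \<and> positive_definite n B \<longrightarrow>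
            loewner_le (fun_mat g (op_mean f A B)) (fun_mat g (geometric_mean A B))"
  show "operator_monotone g"
    using operator_monotone_if_geometric_ge[OF assms transpose_eq_if_perp_ge, of x] perp x g by simp
qed

end
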